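(* For every positive integer $n$ and every $x\neq 0$, $$\sum_{k=0}^{n}\binom nk(-2x)^{n-k}\;{}_4F_3\left[\begin{matrix}\frac{-n+k}{2},\ \frac{-n+k}{2}+1,\ \frac{-n+k}{2}+\frac12,\ \frac{-n+k}{2}+\frac12\\ -n,\ k+2,\ -n+1+k\end{matrix}\;\middle|\;\frac{4}{x^2}\right]U_k(x)=\cos\frac{\pi n}{2}.$$
   Context: The Chebyshev polynomials of the second kind $U_n(x)$ are defined by $\frac{1}{1-2xt+t^2}=\sum_{n\ge 0}U_n(x)t^n$. The generalized hypergeometric function is ${}_4F_3\left[\begin{smallmatrix}a_1,a_2,a_3,a_4\\ b_1,b_2,b_3\end{smallmatrix}\middle| z\right]=\sum_{i\ge0}\frac{(a_1)_i(a_2)_i(a_3)_i(a_4)_i}{(b_1)_i(b_2)_i(b_3)_i}\frac{z^i}{i!}$, with $(a)_i=a(a+1)\cdots(a+i-1)$. Here one of the upper parameters is always a nonpositive integer and some lower parameters may also be nonpositive integers; the series is understood as terminating, i.e. as the finite sum over $0\le i\le\left[\frac{n-k}{2}\right]$ (for these $i$ no denominator vanishes), where $[a]$ is the integer part. *)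

theory Defs
  imports "HOL-Analysis.Analysis"
begin

unbundle fps_syntax

definition chebyshev_U :: "nat \<Rightarrow> 'a::field \<Rightarrow> 'a" where
  "chebyshev_U n x = (1 / (1 - fps_const (2 * x) * fps_X + fps_X ^ 2)) $ n"

lemma chebyshev_U_generating_function:
  fixes x :: "'a::field"
  shows "Abs_fps (\<lambda>n. chebyshev_U n x) * (1 - fps_const (2 * x) * fps_X + fps_X ^ 2) = 1"
proof -
  have "Abs_fps (\<lambda>n. chebyshev_U n x) = inverse (1 - fps_const (2 * x) * fps_X + fps_X ^ 2)"
    by (simp add: chebyshev_U_def fps_eq_iff fps_divide_unit)
  then show ?thesis
    by (simp add: inverse_mult_eq_1)
qed

text \<open>
  The library's hypergeometric series is a formal power series whose last argument is the scaling
  of the formal variable, so its coefficients are the terms of the series at the point \<open>z\<close>.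
  The sum is cut off explicitly: with nonpositive integers among the lower parameters, later
  coefficients can be of the form \<open>0 / 0\<close>.
\<close>
definition hypergeo_sum :: "nat \<Rightarrow> 'a list \<Rightarrow> 'a list \<Rightarrow> 'a \<Rightarrow> 'a::field_char_0" where
  "hypergeo_sum N as bs z = (\<Sum>i\<le>N. fps_hypergeo as bs z $ i)"

lemma hypergeo_sum_4_3:
  "hypergeo_sum N [a1, a2, a3, a4] [b1, b2, b3] z =
    (\<Sum>i\<le>N. pochhammer a1 i * pochhammer a2 i * pochhammer a3 i * pochhammer a4 i /
       (pochhammer b1 i * pochhammer b2 i * pochhammer b3 i) * (z ^ i / fact i))"
  by (simp add: hypergeo_sum_def)

lemma denominators_nonzero:
  fixes n k i :: nat
  assumes "k \<le> n" "i \<le> (n - k) div 2"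
  shows "pochhammer (- of_nat n) i * pochhammer (of_nat k + 2) i
           * pochhammer (- of_nat n + 1 + of_nat k) i \<noteq> (0::'a::field_char_0)"
proof -
  have "pochhammer (- of_nat n :: 'a) i \<noteq> 0"
    using assms by (simp add: pochhammer_of_nat_eq_0_iff)
  moreover have "pochhammer (of_nat k + 2 :: 'a) i \<noteq> 0"
  proof -
    have "of_nat k + 2 + of_nat j \<noteq> (0::'a)" for j
      using of_nat_neq_0[of "k + j + 1", where 'a = 'a] by (simp add: algebra_simps)
    then show ?thesis
      by (auto simp: pochhammer_eq_0_iff eq_neg_iff_add_eq_0)
  qed
  moreover have "pochhammer (- of_nat n + 1 + of_nat k :: 'a) i \<noteq> 0"
  proof (cases "i = 0")
    case False
    with assms have "- of_nat n + 1 + of_nat k = (- of_nat (n - k - 1) :: 'a)" "\<not> n - k - 1 < i"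
      by (auto simp: of_nat_diff)
    then show ?thesis
      by (simp add: pochhammer_of_nat_eq_0_iff)
  qed simp
  ultimately show ?thesis
    by simp
qed

end

theory Submission
  imports Defs
begin

text \<open>
  Put \<open>y = - 2 * x\<close> and let \<open>w = t + \<dots>\<close> be the power series in \<open>t\<close> with
  \<open>w = t * (1 + y * w / (1 - t * w))\<close>. Lagrange inversion shows that the factor of \<open>chebyshev_U k x\<close>
  in the sum is the coefficient of \<open>t ^ (n + 1)\<close> in \<open>w ^ (k + 1)\<close>. So the sum is the coefficient of
  \<open>t ^ (n + 1)\<close> in \<open>w / (1 + y * w + w\<^sup>2)\<close>, and the equation for \<open>w\<close> says that this
  quotient is \<open>t / (1 + t\<^sup>2)\<close>. Both steps are carried out on coefficients: the equation for \<open>w\<close>,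
  multiplied by a power of \<open>w\<close>, is a recurrence that the explicit coefficients satisfy.
\<close>

section \<open>Three-term recurrence of the Chebyshev polynomials\<close>

lemma chebyshev_U_0: "chebyshev_U 0 x = (1::'a::field)"
  and chebyshev_U_1: "chebyshev_U (Suc 0) x = 2 * x"
  and chebyshev_U_rec: "chebyshev_U (Suc (Suc n)) x = 2 * x * chebyshev_U (Suc n) x - chebyshev_U n x"
proof -
  let ?F = "Abs_fps (\<lambda>n. chebyshev_U n x)"
  have F: "?F - fps_const (2 * x) * (?F * fps_X) + ?F * fps_X ^ 2 = 1"
    using chebyshev_U_generating_function[of x] by (simp add: algebra_simps)
  have nth: "(?F - fps_const (2 * x) * (?F * fps_X) + ?F * fps_X ^ 2) $ k = (1 :: 'a fps) $ k" for k
    by (simp only: F)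
  show 0: "chebyshev_U 0 x = 1"
    using nth[of 0] by (simp add: fps_X_power_mult_right_nth)
  show "chebyshev_U (Suc 0) x = 2 * x"
    using nth[of "Suc 0"] 0 by (simp add: fps_X_power_mult_right_nth)
  show "chebyshev_U (Suc (Suc n)) x = 2 * x * chebyshev_U (Suc n) x - chebyshev_U n x"
    using nth[of "Suc (Suc n)"] by (simp add: fps_X_power_mult_right_nth algebra_simps)
qed

text \<open>
  This is the coefficient of \<open>y ^ j * t ^ (K + 2 * i + j)\<close> in \<open>w ^ K\<close>. The case \<open>j = 0\<close> is
  separate because \<open>w = t\<close> for \<open>y = 0\<close>.
\<close>
fun lcoeff :: "nat \<Rightarrow> nat \<Rightarrow> nat \<Rightarrow> 'a::field_char_0" where
  "lcoeff K i 0 = of_bool (i = 0)"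
| "lcoeff K i (Suc j) = of_nat K * fact (K + i + j) * fact (i + j) /
     (fact i * fact j * fact (Suc j) * fact (K + i))"

section \<open>Recurrences for the coefficients of the powers of \<open>w\<close>\<close>

lemma lcoeff_0_left: "lcoeff 0 i j = of_bool (i = 0 \<and> j = 0)"
  by (cases j) auto

lemma lcoeff_1: "lcoeff K i (Suc 0) = of_nat K"
  by (simp del: fact_Suc)

text \<open>Clearing the denominator in the equation for \<open>w\<close> and multiplying by
  \<open>w^K\<close> gives \<open>(1 + t^2) w^(K+1) = t w^(K+2) + t w^K + y t w^(K+1)\<close>. At
  \<open>i = 0\<close> the terms \<open>t^2 w^(K+1)\<close> and \<open>t w^(K+2)\<close> contribute
  nothing.\<close>

lemma lcoeff_rec_0:
  "lcoeff (Suc K) 0 (Suc j) = lcoeff K 0 (Suc j) + (lcoeff (Suc K) 0 j :: 'a::field_char_0)"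
proof (cases j)
  case 0
  then show ?thesis by (simp add: lcoeff_1 del: lcoeff.simps(2))
next
  case (Suc l)
  have nz: "of_nat l + 1 \<noteq> (0::'a)" "of_nat l + 2 \<noteq> (0::'a)" "of_nat K + 1 \<noteq> (0::'a)"
    using of_nat_neq_0[of l, where 'a='a] of_nat_neq_0[of "Suc l", where 'a='a]
      of_nat_neq_0[of K, where 'a='a]
    by (simp_all add: algebra_simps)
  \<comment> \<open>All factorials involved are rational multiples of these three, so naming them
    leaves an identity of rational functions.\<close>
  define f where "f = (fact (K + l) :: 'a)"
  define g where "g = (fact l :: 'a)"
  define h where "h = (fact K :: 'a)"
  have "g \<noteq> 0" "h \<noteq> 0" by (simp_all add: g_def h_def)
  with nz show ?thesis
    unfolding Suc by (simp flip: f_def g_def h_def add: divide_simps add_ac) algebra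
qed

text \<open>Comparison of the coefficients of \<open>y^(j+1) t^(K+2i+j+4)\<close> in the same
  equation.\<close>

lemma lcoeff_rec:
  "lcoeff (Suc K) (Suc i) (Suc j) + lcoeff (Suc K) i (Suc j) =
   lcoeff (Suc (Suc K)) i (Suc j) + lcoeff K (Suc i) (Suc j) + (lcoeff (Suc K) (Suc i) j :: 'a::field_char_0)"
proof (cases j)
  case 0
  then show ?thesis by (simp add: lcoeff_1 del: lcoeff.simps(2))
next
  case (Suc l)
  have nz: "of_nat l + 1 \<noteq> (0::'a)" "of_nat l + 2 \<noteq> (0::'a)" "of_nat i + 1 \<noteq> (0::'a)"
    "of_nat K + of_nat i + 1 \<noteq> (0::'a)" "of_nat K + of_nat i + 2 \<noteq> (0::'a)"
    using of_nat_neq_0[of l, where 'a='a] of_nat_neq_0[of "Suc l", where 'a='a]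
      of_nat_neq_0[of i, where 'a='a] of_nat_neq_0[of "K + i", where 'a='a] 
      of_nat_neq_0[of "Suc (K + i)", where 'a='a]
    by (simp_all add: algebra_simps)
  define f where "f = (fact (K + i + l) :: 'a)"
  define f' where "f' = (fact (i + l) :: 'a)"
  define g where "g = (fact l :: 'a)"
  define g' where "g' = (fact i :: 'a)"
  define h where "h = (fact (K + i) :: 'a)"
  have "g \<noteq> 0" "h \<noteq> 0" "g' \<noteq> 0" by (simp_all add: g_def h_def g'_def)
  with nz show ?thesis
    unfolding Suc by (simp flip: f_def g_def h_def f'_def g'_def add: divide_simps add_ac) algebra
qed

text \<open>One monomial in \<open>y\<close> of the coefficient of \<open>t^(K+m)\<close> in
  \<open>w^K\<close>; the total degree forces the exponent \<open>m - 2 * i\<close>.\<close>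

definition lterm :: "'a \<Rightarrow> nat \<Rightarrow> nat \<Rightarrow> nat \<Rightarrow> 'a::field_char_0" where
  "lterm y K m i = (if 2 * i \<le> m then lcoeff K i (m - 2 * i) * y ^ (m - 2 * i) else 0)"

lemma lterm_rec_0:
  "lterm y (Suc K) (Suc m) 0 = lterm y K (Suc m) 0 + y * lterm y (Suc K) m 0"
  unfolding lterm_def by (simp add: lcoeff_rec_0 algebra_simps del: lcoeff.simps)

lemma lterm_rec:
  "lterm y (Suc K) (m + 2) (Suc i) + lterm y (Suc K) m i =
   lterm y (Suc (Suc K)) m i + lterm y K (m + 2) (Suc i) + y * lterm y (Suc K) (Suc m) (Suc i)"
proof (cases "2 * i < m")
  case True
  then obtain j where j: "m = Suc (2 * i + j)"
    using less_imp_Suc_add by blast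
  show ?thesis
    using arg_cong[OF lcoeff_rec[of K i j, where 'a='a], of "\<lambda>z. z * y ^ Suc j"]
    by (simp add: j lterm_def algebra_simps del: lcoeff.simps)
next
  \<comment> \<open>For \<open>m = 2 * i\<close> only the two terms at \<open>m\<close> and
    \<open>i\<close> can survive, and they agree because \<open>lcoeff\<close> at
    \<open>j = 0\<close> is independent of \<open>K\<close>; for \<open>m < 2 * i\<close> all terms
    are 0.\<close>
  case False
  then show ?thesis by (cases "m = 2 * i") (auto simp: lterm_def)
qed

text \<open>The coefficient of \<open>t ^ (K + m)\<close> in \<open>w ^ K\<close>.\<close>
definition lsum :: "'a \<Rightarrow> nat \<Rightarrow> nat \<Rightarrow> 'a::field_char_0" where
  "lsum y K m = (\<Sum>i\<le>m. lterm y K m i)"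

lemma lsum_alt: "m \<le> N \<Longrightarrow> lsum y K m = (\<Sum>i\<le>N. lterm y K m i)"
  unfolding lsum_def by (rule sum.mono_neutral_left) (auto simp: lterm_def)

lemma lsum_0: "lsum y K 0 = 1"
  by (simp add: lsum_def lterm_def)

lemma lsum_0_left: "m > 0 \<Longrightarrow> lsum y 0 m = 0"
  by (auto simp: lsum_def lterm_def lcoeff_0_left intro!: sum.neutral)

lemma lsum_rec_1: "lsum y (Suc K) (Suc 0) = lsum y K (Suc 0) + y * lsum y (Suc K) 0"
  using lterm_rec_0[of y K 0] by (simp add: lsum_def lterm_def)

text \<open>Summation of \<open>lterm_rec\<close> over \<open>i\<close>; the \<open>i = 0\<close>
  terms left over by the index shift are balanced by \<open>lterm_rec_0\<close>.\<close>

lemma lsum_rec: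
  "lsum y (Suc K) (m + 2) + lsum y (Suc K) m =
   lsum y (Suc (Suc K)) m + lsum y K (m + 2) + y * lsum y (Suc K) (Suc m)"
proof -
  have split: "lsum y K (m + 2) = lterm y K (m + 2) 0 + (\<Sum>i\<le>Suc m. lterm y K (m + 2) (Suc i))" for K
    using sum.atMost_Suc_shift[of "lterm y K (m + 2)" "Suc m"] by (simp add: lsum_def)
  have split': "lsum y (Suc K) (Suc m) = lterm y (Suc K) (Suc m) 0 + (\<Sum>i\<le>Suc m. lterm y (Suc K) (Suc m) (Suc i))"
    using sum.atMost_Suc_shift[of "lterm y (Suc K) (Suc m)" "Suc m"] 
      lsum_alt[of "Suc m" "Suc (Suc m)" y "Suc K"] by simp
  have "(\<Sum>i\<le>Suc m. lterm y (Suc K) (m + 2) (Suc i) + lterm y (Suc K) m i) =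
    (\<Sum>i\<le>Suc m. lterm y (Suc (Suc K)) m i + lterm y K (m + 2) (Suc i) + y * lterm y (Suc K) (Suc m) (Suc i))"
    by (simp only: lterm_rec)
  then show ?thesis
    using lterm_rec_0[of y K "Suc m"]
    unfolding split split' lsum_alt[OF le_SucI[OF order_refl], of y _ m]
    by (simp only: sum.distrib flip: sum_distrib_left) (simp add: algebra_simps)
qed

section \<open>Summation against the Chebyshev polynomials\<close>

text \<open>The coefficient of \<open>t^(n+1)\<close> in the sum of \<open>U_k(x) w^(k+1)\<close>
  over all \<open>k\<close>, with \<open>y = - 2 * x\<close>.\<close>

definition csum :: "'a \<Rightarrow> nat \<Rightarrow> 'a::field_char_0" where
  "csum x n = (\<Sum>k\<le>n. chebyshev_U k x * lsum (- 2 * x) (Suc k) (n - k))"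

text \<open>Coefficient form of \<open>(1 + t^2) w / (1 + y w + w^2) = t\<close>: the recurrence in
  \<open>K\<close> is summed against \<open>U\<close>, and the recurrence of \<open>U\<close>
  cancels the result.\<close>

lemma csum_rec: "csum x (Suc (Suc n)) = - csum x n"
proof -
  define y where "y = - 2 * x"
  define U where "U = (\<lambda>k. chebyshev_U k x)"
  define B where "B = lsum y"
  have csum: "csum x n = (\<Sum>k\<le>n. U k * B (Suc k) (n - k))" for n
    by (simp only: csum_def U_def B_def y_def)
  have U: "U (Suc 0) + y * U 0 = 0" "U k + U (Suc (Suc k)) + y * U (Suc k) = 0" for k
    by (simp_all add: U_def y_def chebyshev_U_0 chebyshev_U_1 chebyshev_U_rec)
  have B: "B (Suc k) (Suc (Suc n) - k) = B (Suc (Suc k)) (n - k) + B k (Suc (Suc n) - k)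
      + y * B (Suc k) (Suc n - k) - B (Suc k) (n - k)" if "k \<le> n" for k
    using lsum_rec[of y k "n - k"] that by (simp add: B_def Suc_diff_le algebra_simps)
  have "csum x (Suc (Suc n)) = (\<Sum>k\<le>n. U k * B (Suc k) (Suc (Suc n) - k)) +
      U (Suc n) * B (Suc (Suc n)) (Suc 0) + U (Suc (Suc n)) * B (Suc (Suc (Suc n))) 0"
    by (simp add: csum)
  also have "(\<Sum>k\<le>n. U k * B (Suc k) (Suc (Suc n) - k)) =
      (\<Sum>k\<le>n. U k * (B (Suc (Suc k)) (n - k) + B k (Suc (Suc n) - k)
      + y * B (Suc k) (Suc n - k) - B (Suc k) (n - k)))"
    by (intro sum.cong) (auto simp: B)
  also have "\<dots> = (\<Sum>k\<le>n. U k * B (Suc (Suc k)) (n - k)) + (\<Sum>k\<le>n. U k * B k (Suc (Suc n) - k))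
      + (\<Sum>k\<le>n. y * U k * B (Suc k) (Suc n - k)) - csum x n"
    by (simp add: csum algebra_simps sum.distrib sum_subtractf)
  also have "B (Suc (Suc n)) (Suc 0) = B (Suc n) (Suc 0) + y * B (Suc (Suc n)) 0"
    by (simp add: B_def lsum_rec_1)
  \<comment> \<open>Since \<open>B k 0 = 1\<close> for every \<open>k\<close>, the boundary terms
    extend the second sum to \<open>n + 2\<close> and the third to \<open>n + 1\<close>.\<close>
  finally have "csum x (Suc (Suc n)) + csum x n =
      (\<Sum>k\<le>n. U k * B (Suc (Suc k)) (n - k)) + (\<Sum>k\<le>Suc (Suc n). U k * B k (Suc (Suc n) - k))
      + (\<Sum>k\<le>Suc n. y * U k * B (Suc k) (Suc n - k))"
    by (simp add: algebra_simps B_def lsum_0)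
  \<comment> \<open>Index shifts bring all sums to the common factor
    \<open>B (Suc (Suc k)) (n - k)\<close>; the term with \<open>B 0\<close> vanishes.\<close>
  also have "(\<Sum>k\<le>Suc (Suc n). U k * B k (Suc (Suc n) - k)) = 
      U (Suc 0) * B (Suc 0) (Suc n) + (\<Sum>k\<le>n. U (Suc (Suc k)) * B (Suc (Suc k)) (n - k))"
    by (simp only: sum.atMost_Suc_shift) (simp add: B_def lsum_0_left)
  also have "(\<Sum>k\<le>Suc n. y * U k * B (Suc k) (Suc n - k)) =
      y * U 0 * B (Suc 0) (Suc n) + (\<Sum>k\<le>n. y * U (Suc k) * B (Suc (Suc k)) (n - k))"
    by (simp only: sum.atMost_Suc_shift) simp
  also have "(\<Sum>k\<le>n. U k * B (Suc (Suc k)) (n - k)) +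
      (U (Suc 0) * B (Suc 0) (Suc n) + (\<Sum>k\<le>n. U (Suc (Suc k)) * B (Suc (Suc k)) (n - k))) +
      (y * U 0 * B (Suc 0) (Suc n) + (\<Sum>k\<le>n. y * U (Suc k) * B (Suc (Suc k)) (n - k))) =
      (U (Suc 0) + y * U 0) * B (Suc 0) (Suc n) +
      (\<Sum>k\<le>n. (U k + U (Suc (Suc k)) + y * U (Suc k)) * B (Suc (Suc k)) (n - k))"
    by (simp add: algebra_simps sum.distrib)
  also have "\<dots> = 0"
    by (simp only: U) simp
  finally show ?thesis
    by (simp add: eq_neg_iff_add_eq_0)
qed

text \<open>Raising \<open>n\<close> by 2 adds \<open>pi\<close> to the argument of the cosine, and
  both sides start with 1 and 0.\<close>

lemma csum_eq_cos: "csum x n = complex_of_real (cos (pi * real n / 2))"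
proof (induction n rule: induct_nat_012)
  case 0
  show ?case by (simp add: csum_def lsum_0 chebyshev_U_0)
next
  case 1
  show ?case
    using lsum_rec_1[of "- 2 * x" 0]
    by (simp add: csum_def lsum_0 lsum_0_left chebyshev_U_0 chebyshev_U_1)
next
  case (ge2 n)
  have "cos (pi * real (Suc (Suc n)) / 2) = cos (pi * real n / 2 + pi)"
    by (simp add: field_simps)
  with ge2 show ?case by (simp add: csum_rec)
qed

section \<open>Identification of the hypergeometric terms\<close>

lemma pochhammer_minus_of_nat:
  assumes "i \<le> n"
  shows "pochhammer (- of_nat n) i = (- 1) ^ i * fact n / (fact (n - i) :: 'a::field_char_0)"
proof -
  have "fact n = fact (n - i) * pochhammer (of_nat n - of_nat i + 1 :: 'a) i"
    using pochhammer_product'[of "1::'a" "n - i" i] assms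
    by (simp only: pochhammer_fact le_add_diff_inverse2) (simp add: of_nat_diff add_ac)
  then show ?thesis by (simp add: pochhammer_minus)
qed

text \<open>The duplication formula pairs the four upper Pochhammer symbols into falling factorials
  of \<open>n - k\<close> and \<open>n - k - 1\<close>; everything else becomes factorials and
  powers.\<close>

lemma hypergeo_term:
  fixes x :: "'a::field_char_0"
  assumes "k \<le> n" "2 * i \<le> n - k" "x \<noteq> 0"
  defines "a \<equiv> (- of_nat n + of_nat k) / 2"
  shows "of_nat (n choose k) * (- 2 * x) ^ (n - k) *
      (pochhammer a i * pochhammer (a + 1) i * pochhammer (a + 1 / 2) i * pochhammer (a + 1 / 2) i /
       (pochhammer (- of_nat n) i * pochhammer (of_nat k + 2) i * pochhammer (- of_nat n + 1 + of_nat k) i)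
       * ((4 / x ^ 2) ^ i / fact i)) = lterm (- 2 * x) (Suc k) (n - k) i"
proof (cases "n - k = 2 * i")
  case True
  then have n: "n = k + 2 * i" using assms(1) by simp
  show ?thesis
  proof (cases "i = 0")
    case True
    then show ?thesis by (simp add: n lterm_def)
  next
    case False
    \<comment> \<open>Here \<open>a + 1\<close> is a nonpositive integer whose Pochhammer symbol
      vanishes, matching the separate case \<open>j = 0\<close> of \<open>lcoeff\<close>.\<close>
    then have "a + 1 = - of_nat (i - 1)"
      by (simp add: a_def n of_nat_diff)
    then have "pochhammer (a + 1) i = 0"
      using False by (simp add: pochhammer_of_nat_eq_0_iff del: of_nat_diff)
    with False show ?thesis by (simp add: n lterm_def)
  qed
next
  case False
  obtain j where n: "n = k + 2 * i + Suc j"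
  proof
    show "n = k + 2 * i + Suc (n - k - 2 * i - 1)"
      using assms(1,2) False by simp
  qed
  have m: "n - k = 2 * i + Suc j" by (simp add: n)
  have "pochhammer (2 * a) (2 * i) = 4 ^ i * pochhammer a i * pochhammer (a + 1 / 2) i"
    by (simp add: pochhammer_double power_mult)
  moreover have "2 * a = - of_nat (2 * i + Suc j)"
    by (simp add: a_def n)
  ultimately have p1: "pochhammer a i * pochhammer (a + 1 / 2) i = fact (2 * i + Suc j) / (fact (Suc j) * 4 ^ i)"
    by (simp add: pochhammer_minus_of_nat field_simps del: of_nat_add of_nat_Suc fact_Suc)
  have half: "a + 1 / 2 + 1 / 2 = a + 1"
    by simp
  have "2 * (a + 1 / 2) = - of_nat (2 * i + j)"
    by (simp add: a_def n field_simps)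
  moreover have "pochhammer (2 * (a + 1 / 2)) (2 * i) =
      4 ^ i * pochhammer (a + 1 / 2) i * pochhammer (a + 1) i"
    unfolding pochhammer_double half by (simp add: power_mult)
  ultimately have "pochhammer (- of_nat (2 * i + j)) (2 * i) =
      4 ^ i * pochhammer (a + 1 / 2) i * pochhammer (a + 1) i"
    by simp
  then have p2: "pochhammer (a + 1) i * pochhammer (a + 1 / 2) i = fact (2 * i + j) / (fact j * 4 ^ i)"
    by (simp add: pochhammer_minus_of_nat divide_simps mult_ac del: of_nat_add)
  have p3: "pochhammer (- of_nat n :: 'a) i = (- 1) ^ i * fact n / fact (k + i + Suc j)"
    by (simp add: pochhammer_minus_of_nat n add_ac del: of_nat_add of_nat_Suc fact_Suc)
  have "- of_nat n + 1 + of_nat k = (- of_nat (2 * i + j) :: 'a)"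
    by (simp add: n)
  then have p4: "pochhammer (- of_nat n + 1 + of_nat k :: 'a) i = (- 1) ^ i * fact (2 * i + j) / fact (i + j)"
    by (simp add: pochhammer_minus_of_nat del: of_nat_add of_nat_Suc fact_Suc)
  have "fact (Suc k + i) = fact (Suc k) * pochhammer (of_nat k + 2 :: 'a) i"
    using pochhammer_product'[of "1::'a" "Suc k" i]
    by (simp only: pochhammer_fact) (simp add: add_ac)
  then have p5: "pochhammer (of_nat k + 2 :: 'a) i = fact (Suc k + i) / fact (Suc k)"
    by (simp add: field_simps del: fact_Suc)
  have p6: "of_nat (n choose k) = fact n / (fact k * fact (2 * i + Suc j) :: 'a)"
    by (subst binomial_fact) (simp_all add: n del: fact_Suc)
  \<comment> \<open>The factor \<open>16 ^ i\<close> cancels the two powers \<open>4 ^ i\<close> in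
    \<open>p1\<close> and \<open>p2\<close>.\<close>
  have pw: "(- 2 * x) ^ (n - k) * (4 / x ^ 2) ^ i = (- 2 * x) ^ Suc j * 16 ^ i"
  proof -
    have "(- 2 * x) ^ (n - k) = (- 2 * x) ^ Suc j * ((- 2 * x) ^ 2) ^ i"
      unfolding m power_add power_mult by (rule mult.commute)
    also have "\<dots> * (4 / x ^ 2) ^ i = (- 2 * x) ^ Suc j * ((- 2 * x) ^ 2 * (4 / x ^ 2)) ^ i"
      by (simp only: power_mult_distrib mult.assoc)
    also have "(- 2 * x) ^ 2 * (4 / x ^ 2) = 16"
      using assms(3) by (simp add: power2_eq_square)
    finally show ?thesis .
  qed
  have "of_nat (n choose k) * (- 2 * x) ^ (n - k) *
      (pochhammer a i * pochhammer (a + 1) i * pochhammer (a + 1 / 2) i * pochhammer (a + 1 / 2) i /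
       (pochhammer (- of_nat n) i * pochhammer (of_nat k + 2) i * pochhammer (- of_nat n + 1 + of_nat k) i)
       * ((4 / x ^ 2) ^ i / fact i)) =
      of_nat (n choose k) * ((- 2 * x) ^ (n - k) * (4 / x ^ 2) ^ i) *
      (pochhammer a i * pochhammer (a + 1 / 2) i) * (pochhammer (a + 1) i * pochhammer (a + 1 / 2) i) /
       (pochhammer (- of_nat n) i * pochhammer (of_nat k + 2) i * pochhammer (- of_nat n + 1 + of_nat k) i
       * fact i)"
    by (simp add: mult_ac)
  also have "\<dots> = (- 2 * x) ^ Suc j * (of_nat (Suc k) * fact (Suc k + i + j) * fact (i + j) /
     (fact i * fact j * fact (Suc j) * fact (Suc k + i)))"
  proof -
    have 16: "(16::'a) ^ i = 4 ^ i * 4 ^ i" by (simp flip: power_mult_distrib)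
    have s: "k + i + Suc j = Suc k + i + j" by simp
    \<comment> \<open>The signs from \<open>p3\<close> and \<open>p4\<close> cancel.\<close>
    have m1: "(- 1 :: 'a) ^ i * (- 1) ^ i = 1" by (simp flip: power_mult_distrib)
    have fk: "(fact (Suc k) :: 'a) = of_nat (Suc k) * fact k" by simp
    show ?thesis
      unfolding pw p1 p2 p3 p4 p5 p6 16 s fk
      using m1 by (simp add: divide_simps del: fact_Suc of_nat_Suc power_Suc of_nat_add)
  qed
  also have "\<dots> = lterm (- 2 * x) (Suc k) (n - k) i"
    unfolding lterm_def m by (simp add: mult_ac del: fact_Suc)
  finally show ?thesis .
qed

lemma hypergeo_sum_eq_lsum:
  fixes x :: "'a::field_char_0"
  assumes "k \<le> n" "x \<noteq> 0"
  shows "of_nat (n choose k) * (- 2 * x) ^ (n - k)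
            * hypergeo_sum ((n - k) div 2)
                [(- of_nat n + of_nat k) / 2,
                 (- of_nat n + of_nat k) / 2 + 1,
                 (- of_nat n + of_nat k) / 2 + 1 / 2,
                 (- of_nat n + of_nat k) / 2 + 1 / 2]
                [- of_nat n, of_nat k + 2, - of_nat n + 1 + of_nat k]
                (4 / x ^ 2) = lsum (- 2 * x) (Suc k) (n - k)"
proof -
  \<comment> \<open>Beyond \<open>(n - k) div 2\<close> the guard in \<open>lterm\<close> makes
    every term 0, so the cutoffs agree.\<close>
  have "lsum (- 2 * x) (Suc k) (n - k) = (\<Sum>i\<le>(n - k) div 2. lterm (- 2 * x) (Suc k) (n - k) i)"
    unfolding lsum_def by (rule sum.mono_neutral_right) (auto simp: lterm_def)
  also have "\<dots> = (\<Sum>i\<le>(n - k) div 2. of_nat (n choose k) * (- 2 * x) ^ (n - k) *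
      (pochhammer ((- of_nat n + of_nat k) / 2) i * pochhammer ((- of_nat n + of_nat k) / 2 + 1) i
       * pochhammer ((- of_nat n + of_nat k) / 2 + 1 / 2) i * pochhammer ((- of_nat n + of_nat k) / 2 + 1 / 2) i /
       (pochhammer (- of_nat n) i * pochhammer (of_nat k + 2) i * pochhammer (- of_nat n + 1 + of_nat k) i)
       * ((4 / x ^ 2) ^ i / fact i)))"
    by (intro sum.cong refl hypergeo_term[symmetric]) (use assms in auto)
  finally show ?thesis
    by (simp only: hypergeo_sum_4_3 sum_distrib_left)
qed

theorem theorem4:
  fixes n :: nat and x :: complex
  assumes "n > 0" and "x \<noteq> 0"
  shows "(\<Sum>k=0..n. of_nat (n choose k) * (- 2 * x) ^ (n - k)
            * hypergeo_sum ((n - k) div 2)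
                [(- of_nat n + of_nat k) / 2,
                 (- of_nat n + of_nat k) / 2 + 1,
                 (- of_nat n + of_nat k) / 2 + 1 / 2,
                 (- of_nat n + of_nat k) / 2 + 1 / 2]
                [- of_nat n, of_nat k + 2, - of_nat n + 1 + of_nat k]
                (4 / x ^ 2)
            * chebyshev_U k x)
         = complex_of_real (cos (pi * real n / 2))"
proof -
  have "(\<Sum>k=0..n. of_nat (n choose k) * (- 2 * x) ^ (n - k)
            * hypergeo_sum ((n - k) div 2)
                [(- of_nat n + of_nat k) / 2,
                 (- of_nat n + of_nat k) / 2 + 1,
                 (- of_nat n + of_nat k) / 2 + 1 / 2,
                 (- of_nat n + of_nat k) / 2 + 1 / 2]
                [- of_nat n, of_nat k + 2, - of_nat n + 1 + of_nat k]
                (4 / x ^ 2)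
            * chebyshev_U k x) = csum x n"
    unfolding csum_def atMost_atLeast0
    by (intro sum.cong refl) (subst hypergeo_sum_eq_lsum, use assms in auto)
  then show ?thesis by (simp only: csum_eq_cos)
qed

end
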